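(* Let $Q_x\subset\mathbb{R}^n$ be a hypercube with side $a>0$ and diameter $R=a\sqrt n$, and let $f$ be a function that is $M_f$-Lipschitz, $\mu_f$-strongly convex and has $L_f$-Lipschitz gradient on $Q_x$ ($M_f,\mu_f,L_f>0$). Consider the multidimensional dichotomy method (described in the context) applied to $\min_{x\in Q_x}f(x)$ with target accuracy $\varepsilon$ in function value. To guarantee that the output point $\hat{\mathbf x}$ of the method satisfies $f(\hat{\mathbf x})-\min_{Q_x}f\le\varepsilon$ it suffices to make $$O\left(2^{n^2}\log_2^n\left(\frac{CR}{\varepsilon}\right)\right),\qquad C=\max\left(M_f,\ \frac{4(M_f+2L_fR)}{L_f},\ \frac{128L_f^2}{\mu_f}\right),$$ calls to the subroutine computing $\nu(\mathbf x)$, where $\nu(\mathbf x)$ is an approximation of the gradient satisfying $\|\nabla f(\mathbf x)-\nu(\mathbf x)\|_2\le\widetilde\delta(\mathbf x)$ at every current point $\mathbf x$. Here the accuracy $\widetilde\delta(\mathbf x)$ is determined by the condition $$C_f\,\widetilde\delta(\mathbf x)+\Delta\le\max\left\{\frac{|\nu_{\perp Q_k}(\mathbf x)|}{L_f},\ \frac{\varepsilon-R\,|\nu_{\perp Q_k}(\mathbf x)|}{M_f+L_fR}\right\},\qquad C_f=\max\left(\frac1{L_f},\frac R{M_f+L_fR}\right),$$ and the auxiliary problems are solved with accuracy in function value $\widetilde\varepsilon\le\dfrac{\mu_f\varepsilon^2}{128L_f^2R^2}$.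
   Context: Multidimensional dichotomy on a box $Q=\prod_{i=1}^n[a_i,b_i]$ with target accuracy $\varepsilon$ and inexact-gradient procedure $\nu$: if $Q$ is a single point, return it. Otherwise perform a prescribed number $N^*$ of outer iterations; in each outer iteration, for $i=1,\dots,n$ successively: (1) put $c=\frac{a_i+b_i}2$ and $Q_{\rm new}=\{x\in Q:x_i=c\}$; (2) compute an approximate minimizer $\mathbf x$ of $f$ on $Q_{\rm new}$ by a recursive call of the same method in dimension one less, with accuracy $\widetilde\varepsilon$ in place of $\varepsilon$ and with inexact gradient obtained from $\nu$ by deleting the $i$-th component; (3) if $\nu_i(\mathbf x)>0$ replace $[a_i,b_i]$ by $[a_i,c]$, otherwise replace it by $[c,b_i]$. After all outer iterations return the center of the remaining box. The number of outer iterations is of order $$\log_2\left(\varepsilon^{-1}R\max\left(M_f,\tfrac{4(M_f+2L_fR)}{L_f}\right)\right).$$ Notation: at a recursion level working on the box $Q$ with slice $Q_k=\{x\in Q:x_k=c\}$, $\nu_{\perp Q_k}(\mathbf x)$ is the scalar component of $\nu(\mathbf x)$ orthogonal to $Q_k$ (the $k$-th component); $\Delta$ is the accuracy in argument with which the auxiliary problem on $Q_k$ is solved (the distance from the approximate solution $\mathbf x\in Q_k$ to the exact minimizer of $f$ on $Q_k$ is at most $\Delta$); $\varepsilon$ in the accuracy conditions is the accuracy required at the current recursion level. The $O(\cdot)$ is understood with an absolute hidden constant, for all $\varepsilon>0$ sufficiently small (depending on $n,R,M_f,L_f,\mu_f$). *)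

theory Defs
  imports "HOL-Analysis.Analysis"
begin

text \<open>
  The hidden constant of the complexity bound must not depend on the dimension n, so n is quantified
  inside the statement. Hence vectors of n-space are functions on nat that vanish from index n on
  (as for \<^const>\<open>Euclidean_space\<close>). The box with corners l and u is the
  interval \<open>{l..u}\<close> of the pointwise order; for corners vanishing from n on it only contains
  vectors of n-space.
\<close>

type_synonym point = "nat \<Rightarrow> real"

definition enorm :: "nat \<Rightarrow> point \<Rightarrow> real" where
  "enorm n x = L2_set x {..<n}"

definition edist :: "nat \<Rightarrow> point \<Rightarrow> point \<Rightarrow> real" where
  "edist n x y = enorm n (\<lambda>i. x i - y i)"

definition cube_upper :: "nat \<Rightarrow> point \<Rightarrow> real \<Rightarrow> point" where
  "cube_upper n l a = (\<lambda>i. if i < n then l i + a else 0)"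


subsection \<open>Function classes\<close>

definition lipschitz_fun :: "nat \<Rightarrow> real \<Rightarrow> point set \<Rightarrow> (point \<Rightarrow> real) \<Rightarrow> bool" where
  "lipschitz_fun n M Q f \<longleftrightarrow> (\<forall>x\<in>Q. \<forall>y\<in>Q. \<bar>f x - f y\<bar> \<le> M * edist n x y)"

definition strongly_convex :: "nat \<Rightarrow> real \<Rightarrow> point set \<Rightarrow> (point \<Rightarrow> real) \<Rightarrow> bool" where
  "strongly_convex n \<mu> Q f \<longleftrightarrow>
     (\<forall>x\<in>Q. \<forall>y\<in>Q. \<forall>t\<in>{0..1}.
        f (\<lambda>i. t * x i + (1 - t) * y i)
          \<le> t * f x + (1 - t) * f y - \<mu> / 2 * t * (1 - t) * (edist n x y)\<^sup>2)"

text \<open>Frechet differentiability relative to Q, so one-sided at the boundary of Q.\<close>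

definition has_gradient_on ::
    "nat \<Rightarrow> point set \<Rightarrow> (point \<Rightarrow> real) \<Rightarrow> (point \<Rightarrow> point) \<Rightarrow> bool" where
  "has_gradient_on n Q f grad \<longleftrightarrow>
     (\<forall>x\<in>Q. \<forall>e>0. \<exists>d>0. \<forall>y\<in>Q. edist n y x < d \<longrightarrow>
        \<bar>f y - f x - (\<Sum>i<n. grad x i * (y i - x i))\<bar> \<le> e * edist n y x)"

definition lipschitz_grad :: "nat \<Rightarrow> real \<Rightarrow> point set \<Rightarrow> (point \<Rightarrow> point) \<Rightarrow> bool" where
  "lipschitz_grad n L Q grad \<longleftrightarrow>
     (\<forall>x\<in>Q. \<forall>y\<in>Q. edist n (grad x) (grad y) \<le> L * edist n x y)"


subsection \<open>The method\<close>

text \<open>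
  The method returns its output point together with the list of all its calls to the inexact
  gradient, including those of the recursive calls. Besides the point \<open>q_pt\<close> at which the
  inexact gradient is computed, a call records the cutting coordinate k, the corners of the slice
  and the accuracy required at the recursion level that issued the call.
\<close>

datatype grad_call =
  Call (q_pt: point) (q_coord: nat) (q_lo: point) (q_hi: point) (q_eps: real)

text \<open>
  \<open>solve\<close> is the solver for the auxiliary problem on a slice. Slices stay embedded in
  n-space, with equal corners in the coordinates fixed so far.
\<close>

definition dich_step ::
    "(point \<Rightarrow> point) \<Rightarrow> (nat \<Rightarrow> point \<Rightarrow> point \<Rightarrow> point \<times> grad_call list) \<Rightarrow> real \<Rightarrow> nat
      \<Rightarrow> point \<times> point \<times> grad_call list \<Rightarrow> point \<times> point \<times> grad_call list" where
  "dich_step \<nu> solve e i = (\<lambda>(l, u, calls).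
     let c = (l i + u i) / 2;
         lo = l(i := c);
         hi = u(i := c);
         (x, sub_calls) = solve i lo hi;
         calls' = calls @ sub_calls @ [Call x i lo hi e]
     in if \<nu> x i > 0 then (l, u(i := c), calls') else (l(i := c), u, calls'))"

text \<open>
  \<open>dichotomy \<nu> N tol m I l u e\<close>: \<open>I\<close> lists the m coordinates not fixed by the
  enclosing recursion levels, \<open>e\<close> is the target accuracy, \<open>N e\<close> the number of outer
  iterations and \<open>tol e\<close> the accuracy for the auxiliary problems. Since only the components of
  \<open>\<nu>\<close> listed in \<open>I\<close> are read, deleting the i-th component of \<open>\<nu>\<close> amounts to removing i
  from \<open>I\<close>.
\<close>

primrec dichotomy ::
    "(point \<Rightarrow> point) \<Rightarrow> (real \<Rightarrow> nat) \<Rightarrow> (real \<Rightarrow> real) \<Rightarrow> nat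
      \<Rightarrow> nat list \<Rightarrow> point \<Rightarrow> point \<Rightarrow> real \<Rightarrow> point \<times> grad_call list" where
  "dichotomy \<nu> N tol 0 I l u e = (l, [])"
| "dichotomy \<nu> N tol (Suc m) I l u e =
     (if l = u then (l, [])
      else
        let solve = (\<lambda>i lo hi. dichotomy \<nu> N tol m (remove1 i I) lo hi (tol e));
            (l', u', calls) = (fold (dich_step \<nu> solve e) I ^^ N e) (l, u, [])
        in (\<lambda>i. (l' i + u' i) / 2, calls))"


subsection \<open>Parameters of the method and accuracy conditions\<close>

definition iter_order :: "real \<Rightarrow> real \<Rightarrow> real \<Rightarrow> real \<Rightarrow> real" where
  "iter_order M L R e = log 2 (R * max M (4 * (M + 2 * L * R) / L) / e)"

definition aux_tol :: "real \<Rightarrow> real \<Rightarrow> real \<Rightarrow> real \<Rightarrow> real" where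
  "aux_tol \<mu> L R e = \<mu> * e\<^sup>2 / (128 * L\<^sup>2 * R\<^sup>2)"

definition C_const :: "real \<Rightarrow> real \<Rightarrow> real \<Rightarrow> real \<Rightarrow> real" where
  "C_const M \<mu> L R = max M (max (4 * (M + 2 * L * R) / L) (128 * L\<^sup>2 / \<mu>))"

definition Cf_const :: "real \<Rightarrow> real \<Rightarrow> real \<Rightarrow> real" where
  "Cf_const M L R = max (1 / L) (R / (M + L * R))"

text \<open>
  The condition on one call, at x with slice \<open>{q_lo q..q_hi q}\<close>: \<open>z\<close> is the exact
  minimizer on the slice and \<open>\<Delta>\<close> the accuracy in argument of x.
\<close>

definition accurate_call ::
    "nat \<Rightarrow> real \<Rightarrow> real \<Rightarrow> real \<Rightarrow> (point \<Rightarrow> real) \<Rightarrow> (point \<Rightarrow> point) \<Rightarrow> (point \<Rightarrow> point)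
      \<Rightarrow> (point \<Rightarrow> real) \<Rightarrow> grad_call \<Rightarrow> bool" where
  "accurate_call n M L R f grad \<nu> \<delta> q \<longleftrightarrow>
     (let x = q_pt q; \<nu>_perp = \<nu> x (q_coord q) in
        edist n (grad x) (\<nu> x) \<le> \<delta> x \<and>
        (\<exists>\<Delta> z. is_arg_min f (\<lambda>y. y \<in> {q_lo q..q_hi q}) z \<and> edist n x z \<le> \<Delta> \<and>
           Cf_const M L R * \<delta> x + \<Delta>
             \<le> max (\<bar>\<nu>_perp\<bar> / L) ((q_eps q - R * \<bar>\<nu>_perp\<bar>) / (M + L * R))))"

end

theory Submission
  imports Defs "HOL-Real_Asymp.Real_Asymp"
begin

text \<open>
  A cut can discard the wrong half of the box only if the first alternative of the accuracy
  condition fails; then the second one bounds the derivative of f across the slice, at the minimizer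
  z on the slice, by \<open>L * e / (M + L * R)\<close>. As f is strongly convex, such a cut raises the
  minimum over the current box by at most the square of this bound over \<open>2 * \<mu>\<close>, that is by
  \<open>O(e\<^sup>2)\<close>, because z belongs to both halves. The \<open>n * N e\<close> cuts of a level thus lose
  \<open>O(e\<^sup>2 * log (1/e))\<close> together, which is below \<open>e / 2\<close> for small e, and the
  Lipschitz bound on the final box costs another \<open>e / 2\<close>.

  As to the number of calls, \<open>W e = log 2 (C * R / e) + log 2 R\<close> at most doubles with each
  recursion level, and a level in dimension j makes \<open>j * N e\<close> recursive calls. This gives a
  factor of order \<open>n! * 2 ^ (n * (n + 1) / 2)\<close> times an exponential in n, which is
  \<open>O(2 ^ n\<^sup>2)\<close>.
\<close>

section \<open>Geometry of boxes\<close>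

lemma edist_nonneg [simp]: "0 \<le> edist n x y"
  by (simp add: edist_def enorm_def)

lemma edist_commute: "edist n x y = edist n y x"
proof -
  have "(\<Sum>i<n. (x i - y i)\<^sup>2) = (\<Sum>i<n. (y i - x i)\<^sup>2)"
    by (intro sum.cong refl) (simp add: power2_commute)
  then show ?thesis by (simp add: edist_def enorm_def L2_set_def)
qed

lemma abs_diff_le_edist:
  assumes "i < n"
  shows "\<bar>x i - y i\<bar> \<le> edist n x y"
proof -
  have "(x i - y i)\<^sup>2 \<le> (\<Sum>j<n. (x j - y j)\<^sup>2)"
    using assms by (intro member_le_sum) auto
  then have "sqrt ((x i - y i)\<^sup>2) \<le> edist n x y"
    unfolding edist_def enorm_def L2_set_def by (rule real_sqrt_le_mono)
  then show ?thesis by simp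
qed

lemma edist_le_sqrt_mult:
  assumes "\<And>i. i < n \<Longrightarrow> \<bar>x i - y i\<bar> \<le> c" and "0 \<le> c"
  shows "edist n x y \<le> sqrt (real n) * c"
proof -
  have "(x i - y i)\<^sup>2 \<le> c\<^sup>2" if "i < n" for i
    using power_mono[OF assms(1)[OF that], of 2] by simp
  then have "(\<Sum>i<n. (x i - y i)\<^sup>2) \<le> (\<Sum>i<n. c\<^sup>2)"
    by (intro sum_mono) simp
  then have "edist n x y \<le> sqrt (real n * c\<^sup>2)"
    by (simp add: edist_def enorm_def L2_set_def)
  then show ?thesis using assms(2) by (simp add: real_sqrt_mult)
qed

lemma edist_segment:
  assumes "0 \<le> t"
  shows "edist n (\<lambda>i. t * y i + (1 - t) * x i) x = t * edist n y x"
proof -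
  have "(\<Sum>i<n. (t * y i + (1 - t) * x i - x i)\<^sup>2) = t\<^sup>2 * (\<Sum>i<n. (y i - x i)\<^sup>2)"
    unfolding sum_distrib_left
    by (intro sum.cong refl) (simp add: power2_eq_square algebra_simps)
  then show ?thesis
    using assms by (simp add: edist_def enorm_def L2_set_def real_sqrt_mult)
qed

lemma segment_in_box:
  fixes l u :: point
  assumes "x \<in> {l..u}" "y \<in> {l..u}" "0 \<le> t" "t \<le> 1"
  shows "(\<lambda>i. t * y i + (1 - t) * x i) \<in> {l..u}"
proof -
  have "l i \<le> t * y i + (1 - t) * x i" "t * y i + (1 - t) * x i \<le> u i" for i
  proof -
    have "l i \<le> x i" "l i \<le> y i" "x i \<le> u i" "y i \<le> u i"
      using assms by (auto simp: le_fun_def)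
    then have "t * l i \<le> t * y i" "(1 - t) * l i \<le> (1 - t) * x i"
      "t * y i \<le> t * u i" "(1 - t) * x i \<le> (1 - t) * u i"
      using assms by (auto intro: mult_left_mono)
    then show "l i \<le> t * y i + (1 - t) * x i" "t * y i + (1 - t) * x i \<le> u i"
      by (auto simp: algebra_simps)
  qed
  then show ?thesis by (auto simp: le_fun_def)
qed


section \<open>First-order conditions\<close>

text \<open>The gradient is relative to the box, so it is accessible through one-sided limits along
  segments inside the box. These also work at boundary points and on degenerate boxes.\<close>

lemma has_gradient_on_directional:
  fixes l u :: point
  assumes grad: "has_gradient_on n {l..u} f grad" and x: "x \<in> {l..u}" and y: "y \<in> {l..u}"
  shows "((\<lambda>t. (f (\<lambda>i. t * y i + (1 - t) * x i) - f x) / t)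
    \<longlongrightarrow> (\<Sum>i<n. grad x i * (y i - x i))) (at_right 0)"
proof (rule tendstoI)
  fix e :: real assume "0 < e"
  define D S where "D = edist n y x" and "S = (\<Sum>i<n. grad x i * (y i - x i))"
  \<comment> \<open>The \<open>+ 1\<close> keeps \<open>e'\<close> positive in the case
    \<open>y = x\<close>, where \<open>D = 0\<close>.\<close>
  define e' where "e' = e / (D + 1)"
  have "0 \<le> D" by (simp add: D_def)
  then have "0 < e'" and e': "e' * D < e" using \<open>0 < e\<close> by (auto simp: e'_def field_simps)
  then obtain d where "0 < d" and d: "\<And>w. w \<in> {l..u} \<Longrightarrow> edist n w x < d \<Longrightarrow>
      \<bar>f w - f x - (\<Sum>i<n. grad x i * (w i - x i))\<bar> \<le> e' * edist n w x"
    using grad x unfolding has_gradient_on_def by meson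
  have "dist ((f (\<lambda>i. t * y i + (1 - t) * x i) - f x) / t) S < e"
    if t: "0 < t" "t < min 1 (d / (D + 1))" for t
  proof -
    define w where "w = (\<lambda>i. t * y i + (1 - t) * x i)"
    have w: "w \<in> {l..u}" unfolding w_def using x y t by (intro segment_in_box) auto
    have dw: "edist n w x = t * D" unfolding w_def D_def using t by (intro edist_segment) auto
    have "t * (D + 1) < d" using t \<open>0 \<le> D\<close> by (simp add: field_simps)
    then have "edist n w x < d" using dw t by (simp add: algebra_simps)
    moreover have "(\<Sum>i<n. grad x i * (w i - x i)) = t * S"
      unfolding S_def sum_distrib_left w_def by (intro sum.cong refl) (simp add: algebra_simps)
    ultimately have "\<bar>f w - f x - t * S\<bar> \<le> e' * (t * D)" using d[OF w] dw by simp
    then have "\<bar>f w - f x - t * S\<bar> / t \<le> e' * D" using t by (simp add: field_simps)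
    moreover have "\<bar>f w - f x - t * S\<bar> / t = \<bar>(f w - f x) / t - S\<bar>"
      using t by (simp add: field_simps abs_if)
    ultimately show ?thesis using e' by (simp add: dist_real_def w_def)
  qed
  moreover have "0 < min 1 (d / (D + 1))" using \<open>0 < d\<close> \<open>0 \<le> D\<close> by simp
  ultimately show "\<forall>\<^sub>F t in at_right 0.
      dist ((f (\<lambda>i. t * y i + (1 - t) * x i) - f x) / t) (\<Sum>i<n. grad x i * (y i - x i)) < e"
    unfolding eventually_at_right_field S_def by blast
qed

text \<open>Strong convexity bounds the difference quotient towards \<open>y\<close>. As
  \<open>t\<close> tends to 0, the factor \<open>1 - t\<close> tends to 1, so the full quadratic
  term survives.\<close>

lemma strongly_convex_first_order:
  fixes l u :: point
  assumes sc: "strongly_convex n \<mu> {l..u} f" and grad: "has_gradient_on n {l..u} f grad"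
    and x: "x \<in> {l..u}" and y: "y \<in> {l..u}"
  shows "f x + (\<Sum>i<n. grad x i * (y i - x i)) + \<mu> / 2 * (edist n y x)\<^sup>2 \<le> f y"
proof -
  define D where "D = edist n y x"
  let ?g = "\<lambda>t. f y - f x - \<mu> / 2 * (1 - t) * D\<^sup>2"
  have "(f (\<lambda>i. t * y i + (1 - t) * x i) - f x) / t \<le> ?g t" if t: "0 < t" "t < 1" for t
  proof -
    have "f (\<lambda>i. t * y i + (1 - t) * x i)
        \<le> t * f y + (1 - t) * f x - \<mu> / 2 * t * (1 - t) * D\<^sup>2"
      using sc x y t unfolding strongly_convex_def D_def by auto
    then have "f (\<lambda>i. t * y i + (1 - t) * x i) - f x \<le> ?g t * t"
      by (simp add: algebra_simps)
    then show ?thesis using t by (simp add: pos_divide_le_eq)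
  qed
  then have "\<forall>\<^sub>F t in at_right 0. (f (\<lambda>i. t * y i + (1 - t) * x i) - f x) / t \<le> ?g t"
    unfolding eventually_at_right_field by (intro exI[of _ 1]) auto
  moreover have "(?g \<longlongrightarrow> ?g 0) (at_right 0)" by (intro tendsto_intros)
  ultimately have "(\<Sum>i<n. grad x i * (y i - x i)) \<le> ?g 0"
    using has_gradient_on_directional[OF grad x y] by (intro tendsto_le[of "at_right 0"]) auto
  then show ?thesis by (simp add: D_def)
qed

text \<open>Difference quotients starting at a minimizer are nonnegative. The box
  \<open>{lo..hi}\<close> will be a slice, and \<open>z\<close> competes only with points of that
  slice.\<close>

lemma gradient_nonneg_at_box_minimizer:
  fixes l u lo hi :: point
  assumes grad: "has_gradient_on n {l..u} f grad" and sub: "{lo..hi} \<subseteq> {l..u}"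
    and z: "is_arg_min f (\<lambda>y. y \<in> {lo..hi}) z" and y: "y \<in> {lo..hi}"
  shows "0 \<le> (\<Sum>i<n. grad z i * (y i - z i))"
proof -
  have zB: "z \<in> {lo..hi}" using z by (simp add: is_arg_min_def)
  have "0 \<le> (f (\<lambda>i. t * y i + (1 - t) * z i) - f z) / t" if t: "0 < t" "t < 1" for t
  proof -
    have "(\<lambda>i. t * y i + (1 - t) * z i) \<in> {lo..hi}"
      using t by (intro segment_in_box zB y) auto
    then have "f z \<le> f (\<lambda>i. t * y i + (1 - t) * z i)"
      using z by (auto simp: is_arg_min_def not_less)
    then show ?thesis using t by simp
  qed
  then have "\<forall>\<^sub>F t in at_right 0. 0 \<le> (f (\<lambda>i. t * y i + (1 - t) * z i) - f z) / t"
    unfolding eventually_at_right_field by (intro exI[of _ 1]) auto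
  moreover have "z \<in> {l..u}" "y \<in> {l..u}" using zB y sub by auto
  ultimately show ?thesis
    using has_gradient_on_directional[OF grad]
    by (intro tendsto_lowerbound[of _ _ "at_right 0"]) auto
qed

text \<open>The displacement from \<open>z\<close> to \<open>p\<close> splits into its k-th part and
  the direction towards \<open>p(k := z k)\<close> inside the slice. The first-order condition on
  the slice makes the second contribution nonnegative, which leaves the derivative across the
  slice.\<close>

lemma slice_minimizer_lower_bound:
  fixes l u lo hi :: point
  assumes sc: "strongly_convex n \<mu> {l..u} f" and grad: "has_gradient_on n {l..u} f grad"
    and "0 < \<mu>" and sub: "{lo..hi} \<subseteq> {l..u}"
    and z: "is_arg_min f (\<lambda>y. y \<in> {lo..hi}) z"
    and p: "p \<in> {l..u}" "p(k := z k) \<in> {lo..hi}" and k: "k < n"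
  shows "f z + grad z k * (p k - z k) + \<mu> / 2 * (p k - z k)\<^sup>2 \<le> f p"
proof -
  have zQ: "z \<in> {l..u}" using z sub by (auto simp: is_arg_min_def)
  have "(\<Sum>i<n. grad z i * (p i - z i))
      = grad z k * (p k - z k) + (\<Sum>i\<in>{..<n} - {k}. grad z i * (p i - z i))"
    using k by (intro sum.remove) auto
  also have "(\<Sum>i\<in>{..<n} - {k}. grad z i * (p i - z i))
      = (\<Sum>i<n. grad z i * ((p(k := z k)) i - z i))"
    using k by (intro sum.mono_neutral_cong_left) auto
  finally have "grad z k * (p k - z k) \<le> (\<Sum>i<n. grad z i * (p i - z i))"
    using gradient_nonneg_at_box_minimizer[OF grad sub z p(2)] by linarith
  \<comment> \<open>Only the k-th part of the quadratic term is kept; a linear loss across the slice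
    will be balanced against it.\<close>
  moreover have "(p k - z k)\<^sup>2 \<le> (edist n p z)\<^sup>2"
    using power_mono[OF abs_diff_le_edist[OF k, of p z], of 2] by simp
  then have "\<mu> / 2 * (p k - z k)\<^sup>2 \<le> \<mu> / 2 * (edist n p z)\<^sup>2"
    using \<open>0 < \<mu>\<close> by (intro mult_left_mono) auto
  ultimately show ?thesis
    using strongly_convex_first_order[OF sc grad zQ p(1)] by linarith
qed


section \<open>Accuracy of the method\<close>

definition in_state :: "point \<Rightarrow> point \<Rightarrow> point \<times> point \<times> grad_call list \<Rightarrow> bool" where
  "in_state l u = (\<lambda>(l', u', calls). l \<le> l' \<and> l' \<le> u' \<and> u' \<le> u)"

lemma dich_step_cases:
  fixes \<nu> solve e k l' u' calls
  defines "c \<equiv> (l' k + u' k) / 2"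
  defines "x \<equiv> fst (solve k (l'(k := c)) (u'(k := c)))"
  defines "calls' \<equiv> calls @ snd (solve k (l'(k := c)) (u'(k := c)))
    @ [Call x k (l'(k := c)) (u'(k := c)) e]"
  shows "dich_step \<nu> solve e k (l', u', calls)
    = (if \<nu> x k > 0 then (l', u'(k := c), calls') else (l'(k := c), u', calls'))"
  by (simp add: dich_step_def Let_def c_def x_def calls'_def split: prod.split)

lemma dich_step_in_state:
  assumes "in_state l u s"
  shows "in_state l u (dich_step \<nu> solve e k s)"
proof -
  obtain l' u' calls where s: "s = (l', u', calls)" by (cases s)
  have "l i \<le> l' i" "l' i \<le> u' i" "u' i \<le> u i" for i
    using assms by (auto simp: s in_state_def le_fun_def)
  moreover from this[of k] have "l' k \<le> (l' k + u' k) / 2" "(l' k + u' k) / 2 \<le> u' k"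
    "l k \<le> (l' k + u' k) / 2" "(l' k + u' k) / 2 \<le> u k"
    by simp_all
  ultimately show ?thesis
    by (auto simp: s dich_step_cases in_state_def le_fun_def)
qed

lemma dich_steps_in_state:
  assumes "in_state l u s"
  shows "in_state l u ((fold (dich_step \<nu> solve e) I ^^ N) s)"
proof (induction N)
  case (Suc N)
  have "in_state l u (fold (dich_step \<nu> solve e) I s')" if "in_state l u s'" for s'
    using that by (induction I arbitrary: s') (simp_all add: dich_step_in_state)
  with Suc show ?case by simp
qed (use assms in simp)

lemma box_center_in_box:
  fixes l u :: point
  assumes "l \<le> u"
  shows "(\<lambda>i. (l i + u i) / 2) \<in> {l..u}"
proof -
  have "l i \<le> u i" for i using assms by (simp add: le_fun_def)
  then show ?thesis by (auto simp: le_fun_def field_simps)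
qed

lemma dichotomy_Suc:
  assumes "l \<noteq> u"
    and "(fold (dich_step \<nu> (\<lambda>i lo hi. dichotomy \<nu> N tol m (remove1 i I) lo hi (tol e)) e) I
      ^^ N e) (l, u, []) = (l', u', calls)"
  shows "dichotomy \<nu> N tol (Suc m) I l u e = (\<lambda>i. (l' i + u' i) / 2, calls)"
  using assms by simp

lemma dichotomy_in_box:
  assumes "l \<le> u"
  shows "fst (dichotomy \<nu> N tol m I l u e) \<in> {l..u}"
proof (cases "m = 0 \<or> l = u")
  case True
  then show ?thesis using assms by (cases m) auto
next
  case False
  then obtain m' where m: "m = Suc m'" and "l \<noteq> u" by (cases m) auto
  obtain l' u' calls where s:
    "(fold (dich_step \<nu> (\<lambda>i lo hi. dichotomy \<nu> N tol m' (remove1 i I) lo hi (tol e)) e) I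
      ^^ N e) (l, u, []) = (l', u', calls)"
    by (metis prod_cases3)
  have "in_state l u (l', u', calls)"
    unfolding s[symmetric] using assms by (intro dich_steps_in_state) (simp add: in_state_def)
  then have "l \<le> l'" "l' \<le> u'" "u' \<le> u" by (auto simp: in_state_def)
  then show ?thesis
    unfolding m dichotomy_Suc[OF \<open>l \<noteq> u\<close> s] using box_center_in_box[of l' u'] by auto
qed

text \<open>Both halves of a cut have equal width, whatever the sign of \<open>\<nu>\<close>.
  Distinctness gives exactly one halving per sweep for each listed coordinate.\<close>

lemma fold_dich_step_width:
  assumes "distinct I" and "s = (l, u, calls)"
    and "fold (dich_step \<nu> solve e) I s = (l', u', calls')"
  shows "u' i - l' i = (if i \<in> set I then (u i - l i) / 2 else u i - l i)"
  using assms
proof (induction I arbitrary: s l u calls)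
  case (Cons k I)
  obtain l1 u1 calls1 where s1: "dich_step \<nu> solve e k s = (l1, u1, calls1)"
    by (metis prod_cases3)
  have "u1 i - l1 i = (if i = k then (u i - l i) / 2 else u i - l i)"
    using s1 unfolding Cons.prems(2) dich_step_cases by (auto simp: field_simps split: if_splits)
  moreover have "u' i - l' i = (if i \<in> set I then (u1 i - l1 i) / 2 else u1 i - l1 i)"
    using Cons.prems s1 by (intro Cons.IH[of _ l1 u1 calls1]) auto
  ultimately show ?case using Cons.prems(1) by auto
qed auto

lemma dich_steps_width:
  assumes "distinct I" "i \<in> set I"
    and "(fold (dich_step \<nu> solve e) I ^^ N) (l, u, calls) = (l', u', calls')"
  shows "u' i - l' i = (u i - l i) / 2 ^ N"
  using assms(3)
proof (induction N arbitrary: l' u' calls')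
  case (Suc N)
  obtain l1 u1 calls1
    where s1: "(fold (dich_step \<nu> solve e) I ^^ N) (l, u, calls) = (l1, u1, calls1)"
    by (metis prod_cases3)
  then have "fold (dich_step \<nu> solve e) I (l1, u1, calls1) = (l', u', calls')"
    using Suc.prems by simp
  from fold_dich_step_width[OF assms(1) refl this] assms(2) Suc.IH[OF s1]
  show ?case by simp
qed simp

section \<open>Effect of a single cut on the minimum over the current box\<close>

locale box_problem =
  fixes n :: nat and M \<mu> L R :: real and l u :: point
    and f :: "point \<Rightarrow> real" and grad \<nu> :: "point \<Rightarrow> point" and \<delta> :: "point \<Rightarrow> real"
  assumes pos: "0 < M" "0 < \<mu>" "0 < L" "0 < R"
    and strongly_convex: "strongly_convex n \<mu> {l..u} f"
    and gradient: "has_gradient_on n {l..u} f grad"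
    and lipschitz_grad: "lipschitz_grad n L {l..u} grad"
begin

text \<open>This is \<open>L\<close> times the second alternative of the accuracy condition, with
  the subtracted term \<open>R * \<bar>\<nu>_perp\<bar>\<close> dropped.\<close>

definition grad_err :: "real \<Rightarrow> real" where
  "grad_err e = L * e / (M + L * R)"

text \<open>
  The largest increase of the minimum over the current box caused by discarding the wrong half.
\<close>

definition cut_loss :: "real \<Rightarrow> real" where
  "cut_loss e = (grad_err e)\<^sup>2 / (2 * \<mu>)"

text \<open>Two errors separate \<open>\<nu> x k\<close> from the derivative at \<open>z\<close>:
  the inexactness at \<open>x\<close>, and the change of the gradient from \<open>x\<close> to
  \<open>z\<close>. Under the first alternative their sum is at most
  \<open>\<bar>\<nu> x k\<bar>\<close>, so the sign cannot flip; under the second it is at most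
  \<open>grad_err e\<close>.\<close>

lemma wrong_sign_derivative_bound:
  assumes acc: "accurate_call n M L R f grad \<nu> \<delta> (Call x k lo hi e)" and "0 < e"
    and sub: "{lo..hi} \<subseteq> {l..u}" and x: "x \<in> {lo..hi}" and k: "k < n"
  obtains z where "is_arg_min f (\<lambda>y. y \<in> {lo..hi}) z"
    "\<nu> x k > 0 \<Longrightarrow> - grad_err e \<le> grad z k" "\<nu> x k \<le> 0 \<Longrightarrow> grad z k \<le> grad_err e"
proof -
  obtain \<Delta> z where \<delta>: "edist n (grad x) (\<nu> x) \<le> \<delta> x"
    and z: "is_arg_min f (\<lambda>y. y \<in> {lo..hi}) z" and \<Delta>: "edist n x z \<le> \<Delta>"
    and max: "Cf_const M L R * \<delta> x + \<Delta>
      \<le> max (\<bar>\<nu> x k\<bar> / L) ((e - R * \<bar>\<nu> x k\<bar>) / (M + L * R))"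
    using acc by (auto simp: accurate_call_def Let_def)
  have "z \<in> {l..u}" "x \<in> {l..u}" using z x sub by (auto simp: is_arg_min_def)
  then have "edist n (grad z) (grad x) \<le> L * edist n x z"
    using lipschitz_grad edist_commute[of n x z] by (auto simp: lipschitz_grad_def)
  also have "\<dots> \<le> L * \<Delta>" using \<Delta> pos by simp
  finally have dz: "\<bar>grad z k - grad x k\<bar> \<le> L * \<Delta>"
    using abs_diff_le_edist[OF k, of "grad z" "grad x"] by linarith
  have dx: "\<bar>grad x k - \<nu> x k\<bar> \<le> \<delta> x"
    using abs_diff_le_edist[OF k, of "grad x" "\<nu> x"] \<delta> by linarith
  \<comment> \<open>\<open>s\<close> is the left side of the accuracy condition with
    \<open>1 / L\<close> in place of \<open>Cf_const\<close>, hence at most that side;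
    \<open>L * s\<close> is the sum of the two errors.\<close>
  define s where "s = \<delta> x / L + \<Delta>"
  have "L * s = \<delta> x + L * \<Delta>" using pos by (simp add: s_def field_simps)
  then have diff: "\<bar>grad z k - \<nu> x k\<bar> \<le> L * s" using dz dx by linarith
  have "0 \<le> \<delta> x" using \<delta> edist_nonneg[of n "grad x" "\<nu> x"] by linarith
  then have "1 / L * \<delta> x \<le> Cf_const M L R * \<delta> x"
    by (intro mult_right_mono) (auto simp: Cf_const_def)
  then have s: "s \<le> max (\<bar>\<nu> x k\<bar> / L) ((e - R * \<bar>\<nu> x k\<bar>) / (M + L * R))"
    using max by (simp add: s_def)
  have MLR: "0 < M + L * R" using pos by (simp add: add_pos_pos)
  have err: "0 \<le> grad_err e" using pos MLR \<open>0 < e\<close> by (simp add: grad_err_def)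
  from s consider "s \<le> \<bar>\<nu> x k\<bar> / L" | "s \<le> (e - R * \<bar>\<nu> x k\<bar>) / (M + L * R)"
    by (auto simp: max_def split: if_splits)
  then have "L * s \<le> \<bar>\<nu> x k\<bar> \<or> L * s \<le> grad_err e"
  proof cases
    case 1
    then show ?thesis using pos by (simp add: field_simps)
  next
    case 2
    have "(e - R * \<bar>\<nu> x k\<bar>) / (M + L * R) \<le> e / (M + L * R)"
      using MLR pos by (intro divide_right_mono) auto
    then have "L * s \<le> L * (e / (M + L * R))" using 2 pos by (intro mult_left_mono) auto
    then show ?thesis by (simp add: grad_err_def)
  qed
  then have "\<nu> x k > 0 \<Longrightarrow> - grad_err e \<le> grad z k" "\<nu> x k \<le> 0 \<Longrightarrow> grad z k \<le> grad_err e"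
    using diff err by linarith+
  with z show thesis by (rule that)
qed

text \<open>A point \<open>p\<close> that survives the cut is its own witness; otherwise the slice
  minimizer \<open>z\<close> is. Quantifying over all \<open>p\<close> instead of a minimizer on the
  box lets the bounds of successive cuts be chained.\<close>

lemma cut_keeps_near_minimizer:
  fixes l' u' :: point and k :: nat
  defines "c \<equiv> (l' k + u' k) / 2"
  assumes acc: "accurate_call n M L R f grad \<nu> \<delta> (Call x k (l'(k := c)) (u'(k := c)) e)"
    and "0 < e" and box: "l \<le> l'" "l' \<le> u'" "u' \<le> u"
    and x: "x \<in> {l'(k := c)..u'(k := c)}" and k: "k < n" and p: "p \<in> {l'..u'}"
  shows "\<exists>p'\<in>(if \<nu> x k > 0 then {l'..u'(k := c)} else {l'(k := c)..u'}). f p' \<le> f p + cut_loss e"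
proof -
  have b: "l i \<le> l' i" "l' i \<le> u' i" "u' i \<le> u i" "l' i \<le> p i" "p i \<le> u' i" for i
    using box p by (auto simp: le_fun_def)
  have c: "l' k \<le> c" "c \<le> u' k" using b(2)[of k] by (auto simp: c_def)
  have sub: "{l'(k := c)..u'(k := c)} \<subseteq> {l'..u'}"
    using c b(2) by (auto simp: le_fun_def split: if_splits)
  have subQ: "{l'..u'} \<subseteq> {l..u}" using box by auto
  obtain z where z: "is_arg_min f (\<lambda>y. y \<in> {l'(k := c)..u'(k := c)}) z"
    and gz: "\<nu> x k > 0 \<Longrightarrow> - grad_err e \<le> grad z k" "\<nu> x k \<le> 0 \<Longrightarrow> grad z k \<le> grad_err e"
    using wrong_sign_derivative_bound[OF acc \<open>0 < e\<close> _ x k] sub subQ by blast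
  have zB: "z \<in> {l'(k := c)..u'(k := c)}" using z by (simp add: is_arg_min_def)
  then have zk: "z k = c" unfolding atLeastAtMost_iff le_fun_def by (metis fun_upd_same order_antisym)
  define d where "d = p k - c"
  define G where "G = grad_err e"
  have "p(k := z k) \<in> {l'(k := c)..u'(k := c)}" using b zk by (auto simp: le_fun_def)
  then have low: "f z + grad z k * d + \<mu> / 2 * d\<^sup>2 \<le> f p"
    using slice_minimizer_lower_bound[OF strongly_convex gradient pos(2) _ z _ _ k, of p] sub subQ p
    unfolding zk d_def by blast
  \<comment> \<open>Completing the square: \<open>cut_loss e\<close> is the maximum of
    \<open>G * t - \<mu> / 2 * t^2\<close> over real \<open>t\<close>.\<close>
  have "0 \<le> (\<mu> * \<bar>d\<bar> - G)\<^sup>2 / (2 * \<mu>)" using pos by simp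
  also have "\<dots> = \<mu> / 2 * d\<^sup>2 + cut_loss e - G * \<bar>d\<bar>"
    using pos by (simp add: cut_loss_def G_def power2_diff field_simps power2_eq_square)
  finally have amgm: "G * \<bar>d\<bar> \<le> \<mu> / 2 * d\<^sup>2 + cut_loss e" by simp
  have loss: "0 \<le> cut_loss e" using pos by (simp add: cut_loss_def)
  show ?thesis
  proof (cases "\<nu> x k > 0")
    case pos_nu: True
    show ?thesis
    proof (cases "p k \<le> c")
      case True
      then have "p \<in> {l'..u'(k := c)}" using b by (auto simp: le_fun_def)
      then show ?thesis using pos_nu loss by (intro bexI[of _ p]) auto
    next
      case False
      then have "0 < d" by (simp add: d_def)
      \<comment> \<open>Here \<open>p\<close> lies in the discarded half and the slope at
        \<open>z\<close> is at least \<open>- G\<close>, so \<open>f z\<close> exceeds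
        \<open>f p\<close> by at most \<open>G * d - \<mu> / 2 * d^2\<close>. The other sign is
        symmetric.\<close>
      then have "- G * d \<le> grad z k * d" using gz(1)[OF pos_nu]
        by (intro mult_right_mono) (auto simp: G_def)
      moreover have "G * \<bar>d\<bar> = G * d" using \<open>0 < d\<close> by simp
      ultimately have "f z \<le> f p + cut_loss e" using low amgm by linarith
      moreover have "z \<in> {l'..u'(k := c)}" using zB sub by auto
      ultimately show ?thesis using pos_nu by auto
    qed
  next
    case neg_nu: False
    show ?thesis
    proof (cases "c \<le> p k")
      case True
      then have "p \<in> {l'(k := c)..u'}" using b by (auto simp: le_fun_def)
      then show ?thesis using neg_nu loss by (intro bexI[of _ p]) auto
    next
      case False
      then have "d < 0" by (simp add: d_def)
      then have "G * d \<le> grad z k * d" using gz(2) neg_nu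
        by (intro mult_right_mono_neg) (auto simp: G_def)
      moreover have "G * \<bar>d\<bar> = - (G * d)" using \<open>d < 0\<close> by simp
      ultimately have "f z \<le> f p + cut_loss e" using low amgm by linarith
      moreover have "z \<in> {l'(k := c)..u'}" using zB sub by auto
      ultimately show ?thesis using neg_nu by auto
    qed
  qed
qed

section \<open>Accumulated loss over all cuts\<close>

definition near_state :: "real \<Rightarrow> nat \<Rightarrow> point \<times> point \<times> grad_call list \<Rightarrow> bool" where
  "near_state e j = (\<lambda>(l', u', calls). in_state l u (l', u', calls) \<and>
     ((\<forall>q\<in>set calls. accurate_call n M L R f grad \<nu> \<delta> q) \<longrightarrow>
       (\<forall>p\<in>{l..u}. \<exists>p'\<in>{l'..u'}. f p' \<le> f p + real j * cut_loss e)))"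

text \<open>Accuracy does not go by induction on the dimension: the condition recorded with each
  call already bounds the distance from \<open>x\<close> to the slice minimizer, so the auxiliary
  solver only has to return a point of its slice.\<close>

lemma dich_step_near_state:
  assumes near: "near_state e j s" and "0 < e" and k: "k < n"
    and solve: "\<And>i lo hi. lo \<le> hi \<Longrightarrow> fst (solve i lo hi) \<in> {lo..hi}"
  shows "near_state e (Suc j) (dich_step \<nu> solve e k s)"
proof -
  obtain l' u' calls where s: "s = (l', u', calls)" by (cases s)
  define c where "c = (l' k + u' k) / 2"
  define x where "x = fst (solve k (l'(k := c)) (u'(k := c)))"
  define calls' where "calls' = calls @ snd (solve k (l'(k := c)) (u'(k := c)))
    @ [Call x k (l'(k := c)) (u'(k := c)) e]"
  have ins: "in_state l u (l', u', calls)" using near by (simp add: s near_state_def)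
  then have box: "l \<le> l'" "l' \<le> u'" "u' \<le> u" by (auto simp: in_state_def)
  then have "l'(k := c) \<le> u'(k := c)" by (auto simp: le_fun_def)
  then have x: "x \<in> {l'(k := c)..u'(k := c)}" unfolding x_def by (rule solve)
  have step: "dich_step \<nu> solve e k s
      = (if \<nu> x k > 0 then (l', u'(k := c), calls') else (l'(k := c), u', calls'))"
    unfolding s dich_step_cases c_def x_def calls'_def ..
  have "\<exists>p'\<in>(if \<nu> x k > 0 then {l'..u'(k := c)} else {l'(k := c)..u'}).
      f p' \<le> f p + real (Suc j) * cut_loss e"
    if acc: "\<forall>q\<in>set calls'. accurate_call n M L R f grad \<nu> \<delta> q" and p: "p \<in> {l..u}" for p
  proof -
    \<comment> \<open>The list of calls only grows, so accuracy of all calls in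
      \<open>calls'\<close> includes that of the earlier ones in \<open>calls\<close>.\<close>
    have "\<forall>p\<in>{l..u}. \<exists>p'\<in>{l'..u'}. f p' \<le> f p + real j * cut_loss e"
      using near acc by (simp add: s near_state_def calls'_def)
    then obtain p1 where p1: "p1 \<in> {l'..u'}" "f p1 \<le> f p + real j * cut_loss e"
      using p by blast
    have "accurate_call n M L R f grad \<nu> \<delta> (Call x k (l'(k := c)) (u'(k := c)) e)"
      using acc by (simp add: calls'_def)
    from cut_keeps_near_minimizer[OF this[unfolded c_def] \<open>0 < e\<close> box x[unfolded c_def] k p1(1)]
    obtain p' where "p' \<in> (if \<nu> x k > 0 then {l'..u'(k := c)} else {l'(k := c)..u'})"
      "f p' \<le> f p1 + cut_loss e"
      unfolding c_def by blast
    then show ?thesis using p1(2) by (intro bexI[of _ p']) (auto simp: algebra_simps)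
  qed
  moreover have "in_state l u (dich_step \<nu> solve e k s)"
    using ins unfolding s by (rule dich_step_in_state)
  ultimately show ?thesis
    unfolding near_state_def step by (auto split: if_splits)
qed

lemma fold_dich_step_near_state:
  assumes "near_state e j s" "0 < e" "\<And>k. k \<in> set I \<Longrightarrow> k < n"
    and "\<And>i lo hi. lo \<le> hi \<Longrightarrow> fst (solve i lo hi) \<in> {lo..hi}"
  shows "near_state e (j + length I) (fold (dich_step \<nu> solve e) I s)"
  using assms(1,3)
proof (induction I arbitrary: j s)
  case (Cons k I)
  then have "near_state e (Suc j) (dich_step \<nu> solve e k s)"
    using assms by (intro dich_step_near_state) auto
  from Cons.IH[OF this] Cons.prems show ?case by simp
qed simp

lemma dich_steps_near_state:
  assumes "l \<le> u" "0 < e" "\<And>k. k \<in> set I \<Longrightarrow> k < n"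
    and "\<And>i lo hi. lo \<le> hi \<Longrightarrow> fst (solve i lo hi) \<in> {lo..hi}"
  shows "near_state e (N * length I) ((fold (dich_step \<nu> solve e) I ^^ N) (l, u, []))"
proof (induction N)
  case 0
  then show ?case using \<open>l \<le> u\<close> by (auto simp: near_state_def in_state_def)
next
  case (Suc N)
  from fold_dich_step_near_state[OF this assms(2-4)] show ?case by (simp add: add.commute)
qed

theorem dichotomy_accuracy:
  assumes lip: "lipschitz_fun n M {l..u} f" and "0 < n" "0 < a" "0 < e"
    and width: "\<And>i. i < n \<Longrightarrow> u i - l i = a" and "l \<le> u" and R: "R = a * sqrt (real n)"
    and iter: "iter_order M L R e \<le> real (N e)"
    and loss: "real (N e * n) * cut_loss e \<le> e / 2"
    and run: "dichotomy \<nu> N tol n [0..<n] l u e = (xhat, calls)"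
    and acc: "\<forall>q\<in>set calls. accurate_call n M L R f grad \<nu> \<delta> q"
    and p: "p \<in> {l..u}"
  shows "f xhat \<le> f p + e"
proof -
  obtain m where n: "n = Suc m" using \<open>0 < n\<close> by (cases n) auto
  \<comment> \<open>The positive side length excludes the early return of
    \<open>dichotomy\<close>.\<close>
  have "l \<noteq> u" using width[of 0] \<open>0 < n\<close> \<open>0 < a\<close> by auto
  define solve where
    "solve = (\<lambda>i lo hi. dichotomy \<nu> N tol m (remove1 i [0..<n]) lo hi (tol e))"
  obtain l' u' calls' where s:
    "(fold (dich_step \<nu> solve e) [0..<n] ^^ N e) (l, u, []) = (l', u', calls')"
    by (metis prod_cases3)
  have "xhat = (\<lambda>i. (l' i + u' i) / 2)" and "calls' = calls"
    using run dichotomy_Suc[OF \<open>l \<noteq> u\<close> s[unfolded solve_def]] unfolding n by auto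
  have "near_state e (N e * length [0..<n]) (l', u', calls)"
    unfolding s[symmetric, unfolded \<open>calls' = calls\<close>] using \<open>l \<le> u\<close> \<open>0 < e\<close>
    by (intro dich_steps_near_state)
      (simp_all only: solve_def set_upt atLeastLessThan_iff dichotomy_in_box)
  then have "near_state e (N e * n) (l', u', calls)" by simp
  then have box: "l \<le> l'" "l' \<le> u'" "u' \<le> u"
    and "\<exists>p'\<in>{l'..u'}. f p' \<le> f p + real (N e * n) * cut_loss e"
    using acc p by (auto simp: near_state_def in_state_def)
  then obtain p' where p': "p' \<in> {l'..u'}" "f p' \<le> f p + e / 2" using loss by force
  \<comment> \<open>\<open>w\<close> is the side of the final box. Its center is within
    \<open>w / 2\<close> of any of its points in each coordinate, which is the source of the one
    half in the bound \<open>e / 2\<close> below.\<close>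
  define w where "w = a / 2 ^ N e"
  have "\<bar>xhat i - p' i\<bar> \<le> w / 2" if "i < n" for i
  proof -
    have "u' i - l' i = w"
      using dich_steps_width[OF _ _ s, of i] width that by (simp add: w_def)
    moreover have "l' i \<le> p' i" "p' i \<le> u' i" using p' by (auto simp: le_fun_def)
    ultimately show ?thesis
      unfolding \<open>xhat = _\<close> abs_le_iff add_divide_distrib by linarith
  qed
  then have "edist n xhat p' \<le> sqrt (real n) * (w / 2)"
    using \<open>0 < a\<close> by (intro edist_le_sqrt_mult) (auto simp: w_def)
  then have "M * edist n xhat p' \<le> M * (sqrt (real n) * (w / 2))"
    using pos by (intro mult_left_mono) auto
  also have "\<dots> = R * M / 2 ^ N e / 2" by (simp add: R w_def)
  also have "\<dots> \<le> e / 2"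
  proof -
    \<comment> \<open>From here on \<open>m\<close> is the maximum inside \<open>iter_order\<close>,
      no longer a dimension. The lower bound on \<open>N e\<close> says
      \<open>R * m \<le> e * 2 ^ N e\<close>.\<close>
    define m where "m = max M (4 * (M + 2 * L * R) / L)"
    have "0 < m" "M \<le> m" using pos by (auto simp: m_def less_max_iff_disj)
    then have "R * m / e = 2 powr iter_order M L R e"
      using pos \<open>0 < e\<close> by (simp add: iter_order_def m_def)
    also have "\<dots> \<le> 2 powr real (N e)" using iter by simp
    finally have "R * m \<le> e * 2 ^ N e" using \<open>0 < e\<close> by (simp add: powr_realpow field_simps)
    moreover have "R * M \<le> R * m" using pos \<open>M \<le> m\<close> by simp
    ultimately have "R * M \<le> e * 2 ^ N e" by linarith
    then show ?thesis by (simp add: field_simps)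
  qed
  finally have "M * edist n xhat p' \<le> e / 2" .
  moreover have "xhat \<in> {l'..u'}" unfolding \<open>xhat = _\<close> using box(2) by (rule box_center_in_box)
  then have "xhat \<in> {l..u}" "p' \<in> {l..u}" using p'(1) box by auto
  then have "\<bar>f xhat - f p'\<bar> \<le> M * edist n xhat p'"
    using lip by (auto simp: lipschitz_fun_def)
  ultimately show ?thesis using p'(2) by linarith
qed

end

section \<open>Number of calls\<close>

lemma fold_dich_step_calls:
  fixes B :: real
  assumes "\<And>k lo hi. k \<in> set I \<Longrightarrow> real (length (snd (solve k lo hi))) + 1 \<le> B"
  shows "real (length (snd (snd (fold (dich_step \<nu> solve e) I s))))
    \<le> real (length (snd (snd s))) + real (length I) * B"
  using assms
proof (induction I arbitrary: s)
  case (Cons k I)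
  obtain l u calls where s: "s = (l, u, calls)" by (cases s)
  define c where "c = (l k + u k) / 2"
  have "length (snd (snd (dich_step \<nu> solve e k s)))
      = length calls + length (snd (solve k (l(k := c)) (u(k := c)))) + 1"
    by (simp add: s dich_step_cases c_def)
  \<comment> \<open>The 1 counts the call issued by this level itself, after those of the recursive
    run.\<close>
  moreover have "real (length (snd (solve k (l(k := c)) (u(k := c))))) + 1 \<le> B"
    using Cons.prems by simp
  ultimately have "real (length (snd (snd (dich_step \<nu> solve e k s)))) \<le> real (length calls) + B"
    by simp
  moreover have "real (length (snd (snd (fold (dich_step \<nu> solve e) I (dich_step \<nu> solve e k s)))))
      \<le> real (length (snd (snd (dich_step \<nu> solve e k s)))) + real (length I) * B"
    using Cons.prems by (intro Cons.IH) auto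
  ultimately show ?case by (simp add: s algebra_simps)
qed simp

lemma dich_steps_calls:
  fixes B :: real
  assumes "\<And>k lo hi. k \<in> set I \<Longrightarrow> real (length (snd (solve k lo hi))) + 1 \<le> B"
  shows "real (length (snd (snd ((fold (dich_step \<nu> solve e) I ^^ N) s))))
    \<le> real (length (snd (snd s))) + real N * (real (length I) * B)"
proof (induction N)
  case (Suc N)
  have "real (length (snd (snd (fold (dich_step \<nu> solve e) I s'))))
      \<le> real (length (snd (snd s'))) + real (length I) * B" for s'
    using assms by (rule fold_dich_step_calls)
  from this[of "(fold (dich_step \<nu> solve e) I ^^ N) s"] Suc.IH
  show ?case by (simp add: algebra_simps)
qed simp

text \<open>A level in dimension \<open>j\<close> makes \<open>j * N e\<close> recursive runs at
  accuracy \<open>tol e\<close>. There \<open>W\<close> has at most doubled, which costs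
  \<open>2 ^ (j - 1)\<close>, and one further 2 absorbs the \<open>+ 1\<close>. The
  \<open>+ 1\<close> in the bound accounts for the call that the enclosing level adds to each
  run.\<close>

lemma dichotomy_calls:
  fixes b \<epsilon> :: real
  assumes "1 \<le> b"
    and N: "\<And>e. 0 < e \<Longrightarrow> e \<le> \<epsilon> \<Longrightarrow> real (N e) \<le> b * W e"
    and W: "\<And>e. 0 < e \<Longrightarrow> e \<le> \<epsilon> \<Longrightarrow> 1 \<le> W e"
    and tol: "\<And>e. 0 < e \<Longrightarrow> e \<le> \<epsilon> \<Longrightarrow> 0 < tol e \<and> tol e \<le> \<epsilon>"
    and W_tol: "\<And>e. 0 < e \<Longrightarrow> e \<le> \<epsilon> \<Longrightarrow> W (tol e) \<le> 2 * W e"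
    and "0 < e" "e \<le> \<epsilon>" "length I = m"
  shows "real (length (snd (dichotomy \<nu> N tol m I l u e))) + 1
    \<le> (\<Prod>j=1..m. b * real j * 2 ^ j) * W e ^ m"
  using assms(6-8)
proof (induction m arbitrary: I l u e)
  case (Suc m)
  define P where "P = (\<Prod>j=1..m. b * real j * 2 ^ j)"
  have "1 \<le> b * real j * 2 ^ j" if "j \<in> {1..m}" for j
    using mult_mono[of 1 "b * real j" 1 "(2::real) ^ j"] mult_mono[of 1 b 1 "real j"] that \<open>1 \<le> b\<close>
    by simp
  then have P: "1 \<le> P" unfolding P_def by (intro prod_ge_1) auto
  note W1 = W[OF Suc.prems(1,2)]
  define solve where "solve = (\<lambda>i lo hi. dichotomy \<nu> N tol m (remove1 i I) lo hi (tol e))"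
  define B where "B = P * (2 * W e) ^ m"
  have "real (length (snd (solve k lo hi))) + 1 \<le> B" if "k \<in> set I" for k lo hi
  proof -
    have "real (length (snd (solve k lo hi))) + 1 \<le> P * W (tol e) ^ m"
      unfolding solve_def P_def using tol[OF Suc.prems(1,2)] Suc.prems(3) that
      by (intro Suc.IH) (auto simp: length_remove1)
    also have "\<dots> \<le> B"
      unfolding B_def using W_tol[OF Suc.prems(1,2)] W[of "tol e"] tol[OF Suc.prems(1,2)] P
      by (intro mult_left_mono power_mono) auto
    finally show ?thesis .
  qed
  then have steps: "real (length (snd (snd ((fold (dich_step \<nu> solve e) I ^^ N e) (l, u, [])))))
      \<le> real (N e) * (real (Suc m) * B)"
    using dich_steps_calls[of I solve B "N e" \<nu> e "(l, u, [])"] Suc.prems(3) by simp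
  have "1 \<le> (2 * W e) ^ m" using W1 by (intro one_le_power) simp
  then have B: "1 \<le> B" using P mult_mono[of 1 P 1 "(2 * W e) ^ m"] by (simp add: B_def)
  have "real (length (snd (dichotomy \<nu> N tol (Suc m) I l u e))) \<le> real (N e) * (real (Suc m) * B)"
  proof (cases "l = u")
    case False
    obtain l' u' calls
      where s: "(fold (dich_step \<nu> solve e) I ^^ N e) (l, u, []) = (l', u', calls)"
      by (metis prod_cases3)
    show ?thesis
      using steps dichotomy_Suc[OF False s[unfolded solve_def]] by (simp only: s snd_conv)
  qed (use B in simp)
  also have "\<dots> \<le> b * W e * (real (Suc m) * B)"
    using N[OF Suc.prems(1,2)] B by (intro mult_right_mono) auto
  \<comment> \<open>All factors are at least 1, so adding 1 to the product at most doubles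
    it.\<close>
  finally have "real (length (snd (dichotomy \<nu> N tol (Suc m) I l u e))) + 1
      \<le> 2 * (b * W e * (real (Suc m) * B))"
    using mult_mono[of 1 "b * W e" 1 "real (Suc m) * B"] mult_mono[of 1 b 1 "W e"]
      mult_mono[of 1 "real (Suc m)" 1 B] B W1 \<open>1 \<le> b\<close> by linarith
  also have "\<dots> = (\<Prod>j=1..Suc m. b * real j * 2 ^ j) * W e ^ Suc m"
    by (simp add: B_def P_def power_mult_distrib)
  finally show ?case .
qed simp

section \<open>A constant independent of the dimension\<close>

lemma bounded_prod_of_tendsto_0:
  fixes b :: "nat \<Rightarrow> real"
  assumes "b \<longlonglongrightarrow> 0" and nonneg: "\<And>j. 0 \<le> b j"
  shows "\<exists>K>0. \<forall>n. (\<Prod>j=1..n. b j) \<le> K"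
proof -
  obtain J where J: "\<And>j. j \<ge> J \<Longrightarrow> b j < 1"
    using order_tendstoD(2)[OF assms(1), of 1] by (auto simp: eventually_sequentially)
  \<comment> \<open>Factors beyond \<open>J\<close> are below 1 and only shrink the product. The
    finitely many others, raised to at least 1, bound it for every \<open>n\<close>.\<close>
  define K where "K = (\<Prod>j\<in>{..J}. max 1 (b j))"
  have "(\<Prod>j=1..n. b j) \<le> K" for n
  proof -
    have "(\<Prod>j=1..n. b j) \<le> (\<Prod>j=1..n. if j \<in> {..J} then max 1 (b j) else 1)"
      using nonneg J by (intro prod_mono) (auto simp: less_imp_le)
    also have "\<dots> = (\<Prod>j\<in>{1..n} \<inter> {..J}. max 1 (b j))"
      by (simp only: prod.inter_restrict[OF finite_atLeastAtMost])
    also have "\<dots> \<le> K"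
      unfolding K_def by (intro prod_mono2) auto
    finally show ?thesis .
  qed
  moreover have "0 < K" unfolding K_def by (intro prod_pos) (auto simp: less_max_iff_disj)
  ultimately show ?thesis by blast
qed

text \<open>\<open>2 ^ (n^2)\<close> is the product of \<open>2 ^ (2 * j - 1)\<close> for
  \<open>j\<close> from 1 to \<open>n\<close>. Dividing it out leaves factors that tend to 0, so the
  factorial costs only a constant. The \<open>2 ^ n\<close> on the left will come from bounding
  \<open>W\<close> by twice the logarithm.\<close>

lemma prod_level_factors_eq:
  fixes b :: real
  shows "2 ^ n * (\<Prod>j=1..n. b * real j * 2 ^ j)
    = 2 ^ (n\<^sup>2) * (\<Prod>j=1..n. 4 * b * real j / 2 ^ j)"
proof (induction n)
  case (Suc n)
  have "(2::real) ^ ((Suc n)\<^sup>2) = 2 ^ (n\<^sup>2) * (2 * 2 ^ n * 2 ^ n)"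
    by (simp add: power2_eq_square power_add)
  with Suc show ?case by (simp add: field_simps)
qed simp

section \<open>Logarithmic estimates for small accuracies\<close>

lemma log_C_const_aux_tol:
  assumes "0 < C" "128 * L\<^sup>2 / \<mu> \<le> C" "0 < \<mu>" "0 < L" "0 < R" "0 < e"
  shows "log 2 (C * R / aux_tol \<mu> L R e) \<le> 2 * log 2 (C * R / e) + log 2 R"
proof -
  \<comment> \<open>The factor \<open>128 * L^2 / \<mu>\<close> coming from \<open>aux_tol\<close>
    is at most \<open>C\<close>, so the quotient is at most the square of \<open>C * R / e\<close>
    times one left-over \<open>R\<close>.\<close>
  have "C * R / aux_tol \<mu> L R e = C * (128 * L\<^sup>2 / \<mu>) * R ^ 3 / e\<^sup>2"
    by (simp add: aux_tol_def power2_eq_square power3_eq_cube field_simps)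
  also have "\<dots> \<le> C * C * R ^ 3 / e\<^sup>2"
    using assms by (intro divide_right_mono mult_right_mono mult_left_mono) auto
  also have "\<dots> = (C * R / e) ^ 2 * R"
    by (simp add: power2_eq_square power3_eq_cube)
  finally have "log 2 (C * R / aux_tol \<mu> L R e) \<le> log 2 ((C * R / e) ^ 2 * R)"
    using assms by (intro log_mono) (auto simp: aux_tol_def)
  also have "\<dots> = 2 * log 2 (C * R / e) + log 2 R"
    using assms by (subst log_mult_pos) (auto simp: log_nat_power)
  finally show ?thesis .
qed

lemma iter_order_le_log_C_const:
  assumes "0 < M" "0 < L" "0 < R" "0 < e"
  shows "iter_order M L R e \<le> log 2 (C_const M \<mu> L R * R / e)"
proof -
  define m where "m = max M (4 * (M + 2 * L * R) / L)"
  have "0 < m" using assms by (simp add: m_def less_max_iff_disj)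
  moreover have "m \<le> C_const M \<mu> L R" unfolding m_def C_const_def by auto
  ultimately show ?thesis
    unfolding iter_order_def m_def[symmetric] using assms
    by (intro log_mono) (auto simp: field_simps)
qed

lemma eventually_small_accuracy:
  fixes c d b :: real
  assumes "0 < c" "0 < d"
  shows "\<forall>\<^sub>F e in at_right 0. b \<le> log 2 (c / e)"
    and "\<forall>\<^sub>F e in at_right 0. d * e\<^sup>2 \<le> e"
    and "\<forall>\<^sub>F e in at_right 0. b * log 2 (c / e) * e\<^sup>2 \<le> e"
proof -
  have "filterlim (\<lambda>e. log 2 (c / e)) at_top (at_right 0)" using assms by real_asymp
  then show "\<forall>\<^sub>F e in at_right 0. b \<le> log 2 (c / e)" by (simp add: filterlim_at_top)
  have "((\<lambda>e. d * e) \<longlongrightarrow> 0) (at_right 0)" using assms by real_asymp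
  then have "\<forall>\<^sub>F e in at_right 0. d * e < 1" by (rule order_tendstoD) simp
  then show "\<forall>\<^sub>F e in at_right 0. d * e\<^sup>2 \<le> e"
    using eventually_at_right_less[of 0] by eventually_elim (simp add: power2_eq_square)
  have "((\<lambda>e. b * (log 2 (c / e) * e)) \<longlongrightarrow> b * 0) (at_right 0)"
    using assms by (intro tendsto_mult_left) real_asymp
  then have "\<forall>\<^sub>F e in at_right 0. b * (log 2 (c / e) * e) < 1"
    by (intro order_tendstoD) auto
  then show "\<forall>\<^sub>F e in at_right 0. b * log 2 (c / e) * e\<^sup>2 \<le> e"
    using eventually_at_right_less[of 0]
    by eventually_elim (simp add: power2_eq_square flip: mult.assoc)
qed

text \<open>\<open>K\<close> is chosen from \<open>\<kappa>\<close> alone, and the threshold before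
  the function and the inexact gradient. Accuracy is claimed for all tolerances up to
  \<open>aux_tol\<close>, the count for \<open>aux_tol\<close> itself, since smaller tolerances make
  the recursive runs longer.\<close>

theorem mainTheorem4:
  fixes \<kappa> :: real
  shows "\<exists>K>0. \<forall>(n::nat) (a::real) (M::real) (\<mu>::real) (L::real) (R::real).
    n \<ge> 1 \<and> a > 0 \<and> M > 0 \<and> \<mu> > 0 \<and> L > 0 \<and> R = a * sqrt (real n) \<longrightarrow>
    (\<exists>\<epsilon>\<^sub>0>0. \<forall>(\<epsilon>::real) (l::point) (u::point) (f::point \<Rightarrow> real) (grad::point \<Rightarrow> point)
        (\<nu>::point \<Rightarrow> point) (\<delta>::point \<Rightarrow> real) (N::real \<Rightarrow> nat) (tol::real \<Rightarrow> real)
        (xhat::point) (calls::grad_call list).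
      0 < \<epsilon> \<and> \<epsilon> < \<epsilon>\<^sub>0 \<and>
      (\<forall>i\<ge>n. l i = 0) \<and> u = cube_upper n l a \<and>
      lipschitz_fun n M {l..u} f \<and>
      strongly_convex n \<mu> {l..u} f \<and>
      has_gradient_on n {l..u} f grad \<and>
      lipschitz_grad n L {l..u} grad \<and>
      (\<forall>e. 0 < e \<and> e \<le> \<epsilon> \<longrightarrow>
         iter_order M L R e \<le> real (N e) \<and> real (N e) \<le> \<kappa> * iter_order M L R e) \<and>
      (\<forall>e. 0 < e \<and> e \<le> \<epsilon> \<longrightarrow> 0 < tol e \<and> tol e \<le> aux_tol \<mu> L R e) \<and>
      (xhat, calls) = dichotomy \<nu> N tol n [0..<n] l u \<epsilon> \<and>
      (\<forall>q\<in>set calls. accurate_call n M L R f grad \<nu> \<delta> q)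
      \<longrightarrow>
      xhat \<in> {l..u} \<and>
      f xhat - (INF x\<in>{l..u}. f x) \<le> \<epsilon> \<and>
      ((\<forall>e. 0 < e \<and> e \<le> \<epsilon> \<longrightarrow> tol e = aux_tol \<mu> L R e) \<longrightarrow>
         real (length calls)
           \<le> K * (2 ^ (n\<^sup>2) * (log 2 (C_const M \<mu> L R * R / \<epsilon>)) ^ n)))"
proof -
  \<comment> \<open>The maximum with 1 ensures \<open>1 \<le> b\<close>; the 2 in \<open>b\<close>
    pays for \<open>lam e \<le> 2 * W e\<close>.\<close>
  define \<kappa>' where "\<kappa>' = max 1 \<kappa>"
  define b where "b = 2 * \<kappa>'"
  have "1 \<le> b" "1 \<le> \<kappa>'" "0 \<le> b" by (auto simp: b_def \<kappa>'_def)
  have "(\<lambda>j. 4 * b * real j / 2 ^ j) \<longlonglongrightarrow> 0" by real_asymp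
  then obtain K where "0 < K" and K: "\<And>n. (\<Prod>j=1..n. 4 * b * real j / 2 ^ j) \<le> K"
    using bounded_prod_of_tendsto_0[of "\<lambda>j. 4 * b * real j / 2 ^ j"] \<open>0 \<le> b\<close> by auto
  show ?thesis
  proof (rule exI[of _ K], intro conjI \<open>0 < K\<close> allI impI, elim conjE)
    fix n :: nat and a M \<mu> L R :: real
    assume n: "n \<ge> 1" and params: "a > 0" "M > 0" "\<mu> > 0" "L > 0" and R: "R = a * sqrt (real n)"
    have "0 < R" using R n params by simp
    define C where "C = C_const M \<mu> L R"
    have "0 < C" and C: "128 * L\<^sup>2 / \<mu> \<le> C"
      using params by (auto simp: C_def C_const_def less_max_iff_disj)
    define r where "r = log 2 R"
    define lam where "lam = (\<lambda>e. log 2 (C * R / e))"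
    define m where "m = max M (4 * (M + 2 * L * R) / L)"
    have "0 < m" using params by (simp add: m_def less_max_iff_disj)
    \<comment> \<open>\<open>h * e^2\<close> will be \<open>cut_loss e\<close>; it depends on the
      constants only, so the threshold can be chosen before \<open>f\<close>.\<close>
    define h where "h = (L / (M + L * R))\<^sup>2 / (2 * \<mu>)"
    \<comment> \<open>For \<open>W e = lam e + r\<close> this yields \<open>1 \<le> W e\<close>,
      \<open>lam e \<le> 2 * W e\<close> and \<open>W e \<le> 2 * lam e\<close>.\<close>
    have "\<forall>\<^sub>F e in at_right 0. 2 * \<bar>r\<bar> + 2 \<le> lam e"
      unfolding lam_def using \<open>0 < C\<close> \<open>0 < R\<close> by (intro eventually_small_accuracy) auto
    \<comment> \<open>This keeps the accuracies of all recursion levels below the threshold.\<close>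
    moreover have "\<forall>\<^sub>F e in at_right 0. \<mu> / (128 * L\<^sup>2 * R\<^sup>2) * e\<^sup>2 \<le> e"
      using params \<open>0 < R\<close> by (intro eventually_small_accuracy[of 1]) auto
    moreover have "\<forall>\<^sub>F e in at_right 0. 0 \<le> log 2 (R * m / e)"
      using \<open>0 < m\<close> \<open>0 < R\<close> by (intro eventually_small_accuracy) auto
    \<comment> \<open>With \<open>N e\<close> at most \<open>\<kappa>' * iter_order M L R e\<close>,
      this bounds the total loss of the \<open>n * N e\<close> cuts by \<open>e / 2\<close>.\<close>
    moreover have "\<forall>\<^sub>F e in at_right 0. 2 * \<kappa>' * real n * h * log 2 (R * m / e) * e\<^sup>2 \<le> e"
      using \<open>0 < m\<close> \<open>0 < R\<close> by (intro eventually_small_accuracy[of _ 1]) auto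
    ultimately have "\<forall>\<^sub>F e in at_right 0. 2 * \<bar>r\<bar> + 2 \<le> lam e \<and> aux_tol \<mu> L R e \<le> e
        \<and> 0 \<le> iter_order M L R e \<and> 2 * \<kappa>' * real n * h * iter_order M L R e * e\<^sup>2 \<le> e"
      by eventually_elim (simp add: aux_tol_def iter_order_def m_def)
    then obtain \<epsilon>\<^sub>0 where "0 < \<epsilon>\<^sub>0" and small: "\<And>e. 0 < e \<Longrightarrow> e < \<epsilon>\<^sub>0 \<Longrightarrow>
        2 * \<bar>r\<bar> + 2 \<le> lam e \<and> aux_tol \<mu> L R e \<le> e
        \<and> 0 \<le> iter_order M L R e \<and> 2 * \<kappa>' * real n * h * iter_order M L R e * e\<^sup>2 \<le> e"
      unfolding eventually_at_right_field by blast
    show "\<exists>\<epsilon>\<^sub>0>0. \<forall>(\<epsilon>::real) (l::point) (u::point) (f::point \<Rightarrow> real) (grad::point \<Rightarrow> point)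
        (\<nu>::point \<Rightarrow> point) (\<delta>::point \<Rightarrow> real) (N::real \<Rightarrow> nat) (tol::real \<Rightarrow> real)
        (xhat::point) (calls::grad_call list).
      0 < \<epsilon> \<and> \<epsilon> < \<epsilon>\<^sub>0 \<and>
      (\<forall>i\<ge>n. l i = 0) \<and> u = cube_upper n l a \<and>
      lipschitz_fun n M {l..u} f \<and>
      strongly_convex n \<mu> {l..u} f \<and>
      has_gradient_on n {l..u} f grad \<and>
      lipschitz_grad n L {l..u} grad \<and>
      (\<forall>e. 0 < e \<and> e \<le> \<epsilon> \<longrightarrow>
         iter_order M L R e \<le> real (N e) \<and> real (N e) \<le> \<kappa> * iter_order M L R e) \<and>
      (\<forall>e. 0 < e \<and> e \<le> \<epsilon> \<longrightarrow> 0 < tol e \<and> tol e \<le> aux_tol \<mu> L R e) \<and>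
      (xhat, calls) = dichotomy \<nu> N tol n [0..<n] l u \<epsilon> \<and>
      (\<forall>q\<in>set calls. accurate_call n M L R f grad \<nu> \<delta> q)
      \<longrightarrow>
      xhat \<in> {l..u} \<and>
      f xhat - (INF x\<in>{l..u}. f x) \<le> \<epsilon> \<and>
      ((\<forall>e. 0 < e \<and> e \<le> \<epsilon> \<longrightarrow> tol e = aux_tol \<mu> L R e) \<longrightarrow>
         real (length calls)
           \<le> K * (2 ^ (n\<^sup>2) * (log 2 (C_const M \<mu> L R * R / \<epsilon>)) ^ n))"
    proof (intro exI[of _ \<epsilon>\<^sub>0] conjI \<open>0 < \<epsilon>\<^sub>0\<close> allI impI; elim conjE)
      fix \<epsilon> :: real and l u :: point and f :: "point \<Rightarrow> real" and grad \<nu> :: "point \<Rightarrow> point"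
        and \<delta> :: "point \<Rightarrow> real" and N :: "real \<Rightarrow> nat" and tol :: "real \<Rightarrow> real"
        and xhat :: point and calls :: "grad_call list"
      assume eps: "0 < \<epsilon>" "\<epsilon> < \<epsilon>\<^sub>0" and l: "\<forall>i\<ge>n. l i = 0" and u: "u = cube_upper n l a"
        and run: "(xhat, calls) = dichotomy \<nu> N tol n [0..<n] l u \<epsilon>"
      have "l \<le> u" using l u params by (auto simp: cube_upper_def le_fun_def)
      show "xhat \<in> {l..u}"
        using dichotomy_in_box[OF \<open>l \<le> u\<close>, of \<nu> N tol n "[0..<n]" \<epsilon>] run by (metis fst_conv)
      assume N: "\<forall>e. 0 < e \<and> e \<le> \<epsilon> \<longrightarrow>
         iter_order M L R e \<le> real (N e) \<and> real (N e) \<le> \<kappa> * iter_order M L R e"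
      have N_le: "real (N e) \<le> \<kappa>' * iter_order M L R e" if e: "0 < e" "e \<le> \<epsilon>" for e
      proof -
        have "real (N e) \<le> \<kappa> * iter_order M L R e" using N e by blast
        \<comment> \<open>Enlarging \<open>\<kappa>\<close> is sound because
          \<open>iter_order\<close> is nonnegative below the threshold.\<close>
        also have "\<dots> \<le> \<kappa>' * iter_order M L R e"
          using small[of e] e eps by (intro mult_right_mono) (auto simp: \<kappa>'_def)
        finally show ?thesis .
      qed
      {
        assume lip: "lipschitz_fun n M {l..u} f"
          and "strongly_convex n \<mu> {l..u} f" "has_gradient_on n {l..u} f grad"
            "lipschitz_grad n L {l..u} grad"
          and acc: "\<forall>q\<in>set calls. accurate_call n M L R f grad \<nu> \<delta> q"
        then interpret box_problem n M \<mu> L R l u f grad \<nu> \<delta>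
          using params \<open>0 < R\<close> by unfold_locales auto
        have h: "cut_loss \<epsilon> = h * \<epsilon>\<^sup>2"
          by (simp add: cut_loss_def grad_err_def h_def power_mult_distrib power_divide)
        have "0 \<le> real n * (h * \<epsilon>\<^sup>2)" using params by (simp add: h_def)
        then have "real (N \<epsilon>) * (real n * (h * \<epsilon>\<^sup>2))
            \<le> \<kappa>' * iter_order M L R \<epsilon> * (real n * (h * \<epsilon>\<^sup>2))"
          using N_le[of \<epsilon>] eps by (intro mult_right_mono) auto
        then have loss: "real (N \<epsilon> * n) * cut_loss \<epsilon> \<le> \<epsilon> / 2"
          using small[of \<epsilon>] eps by (simp add: h mult_ac)
        have "f xhat \<le> f p + \<epsilon>" if "p \<in> {l..u}" for p
          using N eps n run
          by (intro dichotomy_accuracy[where N = N and tol = tol,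
                OF lip _ params(1) eps(1) _ \<open>l \<le> u\<close> R _ loss _ acc that])
            (auto simp: u cube_upper_def)
        then have "f xhat - \<epsilon> \<le> (INF x\<in>{l..u}. f x)"
          using \<open>l \<le> u\<close> by (intro cINF_greatest) (auto simp: algebra_simps)
        then show "f xhat - (INF x\<in>{l..u}. f x) \<le> \<epsilon>" by simp
      }
      assume tol: "\<forall>e. 0 < e \<and> e \<le> \<epsilon> \<longrightarrow> tol e = aux_tol \<mu> L R e"
      \<comment> \<open>The shift by \<open>r\<close> turns
        \<open>lam (tol e) \<le> 2 * lam e + r\<close> into
        \<open>W (tol e) \<le> 2 * W e\<close>.\<close>
      define W where "W = (\<lambda>e. lam e + r)"
      have "real (length (snd (dichotomy \<nu> N tol n [0..<n] l u \<epsilon>))) + 1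
          \<le> (\<Prod>j=1..n. b * real j * 2 ^ j) * W \<epsilon> ^ n"
      proof (rule dichotomy_calls[where \<epsilon> = \<epsilon>, OF \<open>1 \<le> b\<close>])
        fix e :: real assume e: "0 < e" "e \<le> \<epsilon>"
        then have lam: "2 * \<bar>r\<bar> + 2 \<le> lam e" and aux: "aux_tol \<mu> L R e \<le> e"
          using small eps by auto
        show "1 \<le> W e" using lam by (auto simp: W_def)
        show "0 < tol e \<and> tol e \<le> \<epsilon>" using tol aux e params \<open>0 < R\<close> by (auto simp: aux_tol_def)
        show "W (tol e) \<le> 2 * W e"
          using log_C_const_aux_tol[OF \<open>0 < C\<close> C params(3,4) \<open>0 < R\<close> e(1)] tol e
          by (simp add: W_def lam_def r_def)
        have "real (N e) \<le> \<kappa>' * lam e"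
          using N_le[OF e] \<open>1 \<le> \<kappa>'\<close>
            mult_left_mono[OF iter_order_le_log_C_const[OF params(2,4) \<open>0 < R\<close> e(1), of \<mu>], of \<kappa>']
          unfolding lam_def C_def by linarith
        also have "\<dots> \<le> \<kappa>' * (2 * W e)"
          using lam \<open>1 \<le> \<kappa>'\<close> by (intro mult_left_mono) (auto simp: W_def)
        finally show "real (N e) \<le> b * W e" by (simp add: b_def)
      qed (use eps in auto)
      moreover have "snd (dichotomy \<nu> N tol n [0..<n] l u \<epsilon>) = calls" by (simp flip: run)
      ultimately have "real (length calls) \<le> (\<Prod>j=1..n. b * real j * 2 ^ j) * W \<epsilon> ^ n"
        by simp
      also have "\<dots> \<le> (\<Prod>j=1..n. b * real j * 2 ^ j) * (2 * lam \<epsilon>) ^ n"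
        using small[of \<epsilon>] eps \<open>0 \<le> b\<close>
        by (intro mult_left_mono power_mono prod_nonneg) (auto simp: W_def)
      also have "\<dots> = 2 ^ (n\<^sup>2) * (\<Prod>j=1..n. 4 * b * real j / 2 ^ j) * lam \<epsilon> ^ n"
        unfolding prod_level_factors_eq[symmetric] by (simp add: power_mult_distrib)
      also have "\<dots> \<le> 2 ^ (n\<^sup>2) * K * lam \<epsilon> ^ n"
        using K[of n] small[of \<epsilon>] eps by (intro mult_right_mono mult_left_mono) auto
      finally show "real (length calls)
          \<le> K * (2 ^ (n\<^sup>2) * (log 2 (C_const M \<mu> L R * R / \<epsilon>)) ^ n)"
        by (simp add: lam_def C_def mult_ac)
    qed
  qed
qed

end
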